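(* Let $X$ be a real normed vector space, $\Phi: X\rightrightarrows X$ a correspondence, $u: X\to\mathbf{R}$ a function, $\mathcal{I}$ an ideal on $\mathbf{N}$, and $\mathscr{C}$ a nonempty subset of $\mathscr{F}_{\mathrm{K}}$ (the set of feasible paths which are $\mathcal{I}$-contained in a compact set). Assume that: (A1) $\Phi$ is continuous and $\Phi(x)$ is a nonempty compact subset of $X$ for every $x\in X$; (A2) $u$ is continuous; (A3) $\mathcal{I}$ is translation invariant; (A4) there exists a unique $\eta^\star\in\mathrm{Fix}(\Phi)$ which maximizes the restriction of $u$ to $\mathrm{Fix}(\Phi)$; (A5) there exists a continuous linear functional $T: X\to\mathbf{R}$ such that, for all $x\in F:=\{x\in X: u(x)\ge u(\eta^\star)\}$ and all $y\in\Phi(x)$, the inequality $Tx\le Ty$ implies $x=y=\eta^\star$; (A6) $\sup_{\bm{y}\in\mathscr{C}}\mathcal{I}\text{-}\liminf u(\bm{y})\ge u(\eta^\star)$. Let $\bm{x}\in\mathscr{C}$ be an $\mathcal{I}$-optimal path. Then $\mathcal{I}\text{-}\lim\bm{x}=\eta^\star$.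
   Context: $\mathbf{N}$ is the set of nonnegative integers. An ideal $\mathcal{I}\subseteq\mathcal{P}(\mathbf{N})$ is a family closed under finite unions and subsets, containing all finite sets, with $\mathcal{I}\neq\mathcal{P}(\mathbf{N})$. Write $\mathcal{I}^\star=\{S\subseteq\mathbf{N}: \mathbf{N}\setminus S\in\mathcal{I}\}$ and $\mathcal{I}^+=\{S\subseteq\mathbf{N}: S\notin\mathcal{I}\}$. $\mathcal{I}$ is translation invariant if $(A+k)\cap\mathbf{N}\in\mathcal{I}$ for all $A\in\mathcal{I}$ and all $k\in\mathbf{Z}$ (possibly negative). A sequence $\bm{x}=(x_n)$ is $\mathcal{I}$-convergent to $\eta$, written $\mathcal{I}\text{-}\lim\bm{x}=\eta$, if $\{n\in\mathbf{N}: x_n\in U\}\in\mathcal{I}^\star$ for all open neighborhoods $U$ of $\eta$. For a real sequence $\bm{a}=(a_n)$ such that $\{n: |a_n|\ge M\}\in\mathcal{I}$ for some $M\in\mathbf{R}$, define $\mathcal{I}\text{-}\liminf\bm{a}:=\inf\{r\in\mathbf{R}: \{n\in\mathbf{N}: a_n<r\}\in\mathcal{I}^+\}$. A correspondence $\Phi: X\rightrightarrows X$ assigns to each $x\in X$ a (possibly empty) subset $\Phi(x)\subseteq X$; $\mathrm{Fix}(\Phi)=\{x\in X: x\in\Phi(x)\}$. $\Phi$ is upper hemicontinuous at $x$ if for each open $U\supseteq\Phi(x)$ there is an open neighborhood $V$ of $x$ with $\Phi(z)\subseteq U$ for all $z\in V$; lower hemicontinuous at $x$ if for each open $U$ with $\Phi(x)\cap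 U\neq\emptyset$ there is an open neighborhood $V$ of $x$ with $\Phi(z)\cap U\neq\emptyset$ for all $z\in V$; continuous if both hold at every point. A feasible path is a sequence $\bm{x}=(x_0,x_1,\ldots)\in X^{\mathbf{N}}$ with $x_{n+1}\in\Phi(x_n)$ for all $n\in\mathbf{N}$. $\mathscr{F}_{\mathrm{K}}$ is the set of feasible paths $\bm{x}$ for which there is a nonempty compact $K\subseteq X$ with $\{n: x_n\notin K\}\in\mathcal{I}$. For a sequence $\bm{x}$ in $X$, $u(\bm{x})$ denotes $(u(x_0),u(x_1),\ldots)$; if $u$ is continuous and $\bm{x}\in\mathscr{F}_{\mathrm{K}}$, then $\mathcal{I}\text{-}\liminf u(\bm{x})$ is well defined. A path $\bm{x}\in\mathscr{C}$ is $\mathcal{I}$-optimal if $\mathcal{I}\text{-}\liminf u(\bm{x})\ge\mathcal{I}\text{-}\liminf u(\bm{y})$ for all $\bm{y}\in\mathscr{C}$. *)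

theory Defs
  imports "HOL-Analysis.Analysis"
begin

section \<open>Ideals on the natural numbers\<close>

definition nat_ideal :: "nat set set \<Rightarrow> bool" where
  "nat_ideal \<I> \<longleftrightarrow>
     (\<forall>A\<in>\<I>. \<forall>B\<in>\<I>. A \<union> B \<in> \<I>) \<and>
     (\<forall>A\<in>\<I>. \<forall>B. B \<subseteq> A \<longrightarrow> B \<in> \<I>) \<and>
     (\<forall>A. finite A \<longrightarrow> A \<in> \<I>) \<and>
     \<I> \<noteq> UNIV"

definition dual_filter :: "nat set set \<Rightarrow> nat set set" where
  "dual_filter \<I> = {S. - S \<in> \<I>}"

definition positive_sets :: "nat set set \<Rightarrow> nat set set" where
  "positive_sets \<I> = {S. S \<notin> \<I>}"

text \<open>The shift by \<open>k\<close> ranges over all integers; elements that would become negative are dropped.\<close>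

definition shift_set :: "nat set \<Rightarrow> int \<Rightarrow> nat set" where
  "shift_set A k = {n. \<exists>a\<in>A. int n = int a + k}"

definition translation_invariant :: "nat set set \<Rightarrow> bool" where
  "translation_invariant \<I> \<longleftrightarrow> (\<forall>A\<in>\<I>. \<forall>k::int. shift_set A k \<in> \<I>)"

definition ideal_converges ::
  "nat set set \<Rightarrow> (nat \<Rightarrow> 'a::topological_space) \<Rightarrow> 'a \<Rightarrow> bool" where
  "ideal_converges \<I> x \<eta> \<longleftrightarrow> (\<forall>U. open U \<and> \<eta> \<in> U \<longrightarrow> {n. x n \<in> U} \<in> dual_filter \<I>)"

text \<open>Meaningful only if \<open>{n. \<bar>a n\<bar> \<ge> M} \<in> \<I>\<close> for some \<open>M\<close>: then the set below is nonempty and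
  bounded below, so the real infimum is the genuine one.\<close>

definition ideal_liminf :: "nat set set \<Rightarrow> (nat \<Rightarrow> real) \<Rightarrow> real" where
  "ideal_liminf \<I> a = Inf {r. {n. a n < r} \<in> positive_sets \<I>}"

section \<open>Correspondences\<close>

definition Fix :: "('a \<Rightarrow> 'a set) \<Rightarrow> 'a set" where
  "Fix \<Phi> = {x. x \<in> \<Phi> x}"

definition upper_hemicontinuous_at ::
  "('a::topological_space \<Rightarrow> 'b::topological_space set) \<Rightarrow> 'a \<Rightarrow> bool" where
  "upper_hemicontinuous_at \<Phi> x \<longleftrightarrow>
     (\<forall>U. open U \<and> \<Phi> x \<subseteq> U \<longrightarrow> (\<exists>V. open V \<and> x \<in> V \<and> (\<forall>z\<in>V. \<Phi> z \<subseteq> U)))"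

definition lower_hemicontinuous_at ::
  "('a::topological_space \<Rightarrow> 'b::topological_space set) \<Rightarrow> 'a \<Rightarrow> bool" where
  "lower_hemicontinuous_at \<Phi> x \<longleftrightarrow>
     (\<forall>U. open U \<and> \<Phi> x \<inter> U \<noteq> {} \<longrightarrow>
        (\<exists>V. open V \<and> x \<in> V \<and> (\<forall>z\<in>V. \<Phi> z \<inter> U \<noteq> {})))"

definition continuous_correspondence ::
  "('a::topological_space \<Rightarrow> 'b::topological_space set) \<Rightarrow> bool" where
  "continuous_correspondence \<Phi> \<longleftrightarrow>
     (\<forall>x. upper_hemicontinuous_at \<Phi> x \<and> lower_hemicontinuous_at \<Phi> x)"

section \<open>Feasible and optimal paths\<close>

definition feasible_path :: "('a \<Rightarrow> 'a set) \<Rightarrow> (nat \<Rightarrow> 'a) \<Rightarrow> bool" where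
  "feasible_path \<Phi> x \<longleftrightarrow> (\<forall>n. x (Suc n) \<in> \<Phi> (x n))"

definition feasible_paths_K ::
  "nat set set \<Rightarrow> ('a::topological_space \<Rightarrow> 'a set) \<Rightarrow> (nat \<Rightarrow> 'a) set" where
  "feasible_paths_K \<I> \<Phi> =
     {x. feasible_path \<Phi> x \<and> (\<exists>K. K \<noteq> {} \<and> compact K \<and> {n. x n \<notin> K} \<in> \<I>)}"

definition ideal_optimal ::
  "nat set set \<Rightarrow> ('a \<Rightarrow> real) \<Rightarrow> (nat \<Rightarrow> 'a) set \<Rightarrow> (nat \<Rightarrow> 'a) \<Rightarrow> bool" where
  "ideal_optimal \<I> u C x \<longleftrightarrow>
     x \<in> C \<and> (\<forall>y\<in>C. ideal_liminf \<I> (u \<circ> x) \<ge> ideal_liminf \<I> (u \<circ> y))"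

end

theory Submission
  imports Defs
begin

text \<open>
  Let \<open>\<Gamma>\<close> be the set of cluster points of the optimal path along the filter dual to the ideal.
  It is compact, and optimality together with (A6) puts it inside \<open>{z. u z \<ge> u \<eta>}\<close>. Translation
  invariance and upper hemicontinuity give every \<open>z \<in> \<Gamma>\<close> a successor \<open>y \<in> \<Phi> z \<inter> \<Gamma>\<close>
  and a predecessor \<open>w \<in> \<Gamma>\<close> with \<open>z \<in> \<Phi> w\<close>. Applying (A5) to a minimizer of \<open>T\<close> on
  \<open>\<Gamma>\<close> and its successor, and to a maximizer and its predecessor, shows that both equal \<open>\<eta>\<close>.
  So \<open>T\<close> is constant on \<open>\<Gamma>\<close>, and (A5) applied to any point and its successor
  gives \<open>\<Gamma> \<subseteq> {\<eta>}\<close>. A path eventually in a compact set converges to its only cluster point.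
\<close>

section \<open>Cluster points along a filter and the closed graph property\<close>

text \<open>This form is chosen because the infimum itself is a proper filter finer than
  \<open>F\<close> along which \<open>x\<close> tends to \<open>z\<close>. Such filters replace
  convergent subsequences throughout.\<close>

definition cluster_point :: "'i filter \<Rightarrow> ('i \<Rightarrow> 'a::topological_space) \<Rightarrow> 'a \<Rightarrow> bool" where
  "cluster_point F x z \<longleftrightarrow> inf F (filtercomap x (nhds z)) \<noteq> bot"

lemma cluster_point_iff_frequently:
  "cluster_point F x z \<longleftrightarrow> (\<forall>U. open U \<and> z \<in> U \<longrightarrow> (\<exists>\<^sub>F n in F. x n \<in> U))"
proof
  assume nb: "cluster_point F x z"
  show "\<forall>U. open U \<and> z \<in> U \<longrightarrow> (\<exists>\<^sub>F n in F. x n \<in> U)"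
  proof (intro allI impI)
    fix U assume U: "open U \<and> z \<in> U"
    show "\<exists>\<^sub>F n in F. x n \<in> U"
    proof (rule ccontr)
      assume "\<not> (\<exists>\<^sub>F n in F. x n \<in> U)"
      then have 1: "\<forall>\<^sub>F n in F. x n \<notin> U" by (simp add: not_frequently)
      have 2: "\<forall>\<^sub>F n in filtercomap x (nhds z). x n \<in> U"
        using U by (intro eventually_filtercomapI eventually_nhds_in_open) auto
      have "\<forall>\<^sub>F n in inf F (filtercomap x (nhds z)). False"
        unfolding eventually_inf by (rule exI, rule exI) (use 1 2 in auto)
      then show False using nb by (simp add: cluster_point_def trivial_limit_def)
    qed
  qed
next
  assume H: "\<forall>U. open U \<and> z \<in> U \<longrightarrow> (\<exists>\<^sub>F n in F. x n \<in> U)"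
  show "cluster_point F x z" unfolding cluster_point_def
  proof
    assume "inf F (filtercomap x (nhds z)) = bot"
    then have "\<forall>\<^sub>F n in inf F (filtercomap x (nhds z)). False" by simp
    then obtain P Q where P: "eventually P F" and Q: "eventually Q (filtercomap x (nhds z))"
      and PQ: "\<And>n. P n \<Longrightarrow> Q n \<Longrightarrow> False" unfolding eventually_inf by auto
    obtain R where "eventually R (nhds z)" and RQ: "\<And>n. R (x n) \<Longrightarrow> Q n"
      using Q unfolding eventually_filtercomap by auto
    then obtain U where U: "open U" "z \<in> U" "\<And>y. y \<in> U \<Longrightarrow> R y"
      unfolding eventually_nhds by auto
    have "\<exists>\<^sub>F n in F. x n \<in> U" using H U by auto
    moreover have "\<forall>\<^sub>F n in F. x n \<notin> U"
      using P by eventually_elim (use PQ RQ U in blast)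
    ultimately show False by (simp add: frequently_def)
  qed
qed

lemma cluster_pointI:
  assumes "G \<noteq> bot" "G \<le> F" "(x \<longlongrightarrow> z) G"
  shows "cluster_point F x z"
proof -
  have "G \<le> inf F (filtercomap x (nhds z))"
    using assms(2,3) by (simp add: filterlim_iff_le_filtercomap)
  then show ?thesis using assms(1) unfolding cluster_point_def by (metis bot.extremum_uniqueI)
qed

lemma cluster_pointE:
  assumes "cluster_point F x z"
  obtains G where "G \<noteq> bot" "G \<le> F" "(x \<longlongrightarrow> z) G"
proof
  show "inf F (filtercomap x (nhds z)) \<noteq> bot" using assms by (simp add: cluster_point_def)
  show "(x \<longlongrightarrow> z) (inf F (filtercomap x (nhds z)))"
    by (simp add: filterlim_iff_le_filtercomap)
qed simp

lemma closed_cluster_points: "closed {z. cluster_point F x z}"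
proof -
  \<comment> \<open>The complement is the union of the open sets that \<open>x\<close> does not
    visit frequently.\<close>
  have "open (\<Union>{U. open U \<and> \<not> (\<exists>\<^sub>F n in F. x n \<in> U)})" by auto
  also have "\<Union>{U. open U \<and> \<not> (\<exists>\<^sub>F n in F. x n \<in> U)} = - {z. cluster_point F x z}"
    unfolding cluster_point_iff_frequently by auto
  finally show ?thesis by (simp add: closed_def)
qed

lemma cluster_point_in_closed:
  assumes "closed K" "\<forall>\<^sub>F n in F. x n \<in> K" "cluster_point F x z"
  shows "z \<in> K"
  using assms by (metis Lim_in_closed_set cluster_pointE filter_leD)

text \<open>Filter compactness is applied to the image of \<open>F\<close> under \<open>x\<close>;
  the characterization by frequent visits carries the point found back to \<open>F\<close>.\<close>

lemma compact_imp_cluster_point: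
  assumes "compact K" "F \<noteq> bot" "\<forall>\<^sub>F n in F. x n \<in> K"
  obtains z where "z \<in> K" "cluster_point F x z"
proof -
  have "\<exists>z\<in>K. inf (nhds z) (filtermap x F) \<noteq> bot"
    using assms unfolding compact_filter by (simp add: eventually_filtermap filtermap_bot_iff)
  then obtain z where z: "z \<in> K" "inf (nhds z) (filtermap x F) \<noteq> bot" by auto
  have "cluster_point (filtermap x F) (\<lambda>y. y) z"
    using z(2) by (simp add: cluster_point_def filtercomap_ident inf.commute)
  then have "cluster_point F x z"
    unfolding cluster_point_iff_frequently by (simp add: frequently_def eventually_filtermap)
  then show ?thesis using that z by auto
qed

text \<open>If convergence failed at \<open>U\<close>, restricting \<open>F\<close> to the indices
  with \<open>x n\<close> outside \<open>U\<close> would leave a proper filter, and the compact set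
  \<open>K - U\<close> would contain a second cluster point.\<close>

lemma unique_cluster_point_tendsto:
  fixes \<eta> :: "'a::topological_space"
  assumes K: "compact K" "\<forall>\<^sub>F n in F. x n \<in> K"
    and unique: "\<And>z. cluster_point F x z \<Longrightarrow> z = \<eta>"
  shows "(x \<longlongrightarrow> \<eta>) F"
proof (rule topological_tendstoI, rule ccontr)
  fix U assume U: "open U" "\<eta> \<in> U" and ne: "\<not> (\<forall>\<^sub>F n in F. x n \<in> U)"
  define G where "G = inf F (principal {n. x n \<notin> U})"
  have "G \<noteq> bot"
    using ne unfolding G_def trivial_limit_def eventually_inf_principal by simp
  moreover have "\<forall>\<^sub>F n in G. x n \<in> K - U"
    unfolding G_def eventually_inf_principal using K(2) by eventually_elim auto
  moreover have "compact (K - U)" using K(1) U(1) by (rule compact_diff)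
  ultimately obtain z where z: "z \<in> K - U" "cluster_point G x z"
    by (metis compact_imp_cluster_point)
  have "cluster_point F x z"
    using z(2) by (rule cluster_pointE) (auto simp: G_def intro: cluster_pointI)
  then show False using unique z(1) U(2) by auto
qed

text \<open>Regularity separates \<open>y\<close> from \<open>\<Phi> z\<close> by disjoint open sets
  \<open>W\<close> and \<open>U\<close>. Near \<open>z\<close> the values of \<open>\<Phi>\<close>
  lie in \<open>U\<close>, while \<open>g n\<close> eventually lies in \<open>W\<close>.\<close>

lemma upper_hemicontinuous_closed_graph:
  fixes \<Phi> :: "'a::topological_space \<Rightarrow> 'b::t3_space set"
  assumes "upper_hemicontinuous_at \<Phi> z" "closed (\<Phi> z)" "G \<noteq> bot"
    and "(f \<longlongrightarrow> z) G" "(g \<longlongrightarrow> y) G" "\<forall>\<^sub>F n in G. g n \<in> \<Phi> (f n)"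
  shows "y \<in> \<Phi> z"
proof (rule ccontr)
  assume "y \<notin> \<Phi> z"
  with assms(2) obtain W U where W: "open W" "y \<in> W"
    and U: "open U" "\<Phi> z \<subseteq> U" "W \<inter> U = {}"
    using t3_space by metis
  obtain V where V: "open V" "z \<in> V" "\<And>w. w \<in> V \<Longrightarrow> \<Phi> w \<subseteq> U"
    using assms(1) U unfolding upper_hemicontinuous_at_def by metis
  have "\<forall>\<^sub>F n in G. f n \<in> V" "\<forall>\<^sub>F n in G. g n \<in> W"
    using assms(4,5) V W by (auto dest: topological_tendstoD)
  with assms(6) have "\<forall>\<^sub>F n in G. False"
    by eventually_elim (use V U in blast)
  then show False using assms(3) by (simp add: trivial_limit_def)
qed

section \<open>The filter dual to an ideal\<close>

definition ideal_filter :: "nat set set \<Rightarrow> nat filter" where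
  "ideal_filter \<I> = Abs_filter (\<lambda>P. {n. \<not> P n} \<in> \<I>)"

lemma eventually_ideal_filter:
  assumes "nat_ideal \<I>"
  shows "eventually P (ideal_filter \<I>) \<longleftrightarrow> {n. \<not> P n} \<in> \<I>"
  unfolding ideal_filter_def
proof (rule eventually_Abs_filter, unfold_locales)
  show "{n. \<not> True} \<in> \<I>" using assms by (simp add: nat_ideal_def)
next
  fix P Q assume "{n. \<not> P n} \<in> \<I>" "{n. \<not> Q n} \<in> \<I>"
  then have "{n. \<not> P n} \<union> {n. \<not> Q n} \<in> \<I>" using assms by (simp add: nat_ideal_def)
  then show "{n. \<not> (P n \<and> Q n)} \<in> \<I>" by (simp add: Un_def)
next
  fix P Q assume PQ: "\<forall>n. P n \<longrightarrow> Q n" and "{n. \<not> P n} \<in> \<I>"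
  moreover have "{n. \<not> Q n} \<subseteq> {n. \<not> P n}" using PQ by auto
  ultimately show "{n. \<not> Q n} \<in> \<I>" using assms unfolding nat_ideal_def by blast
qed

text \<open>The shift by -1 gives \<open>filtermap Suc F \<le> F\<close>, which produces successors
  of cluster points; the shift by 1 gives the reverse inequality, which produces
  predecessors.\<close>

lemma filtermap_Suc_ideal_filter:
  assumes "nat_ideal \<I>" "translation_invariant \<I>"
  shows "filtermap Suc (ideal_filter \<I>) = ideal_filter \<I>"
proof (rule filter_eq_iff[THEN iffD2], rule allI)
  fix P
  have "{n. \<not> P (Suc n)} \<in> \<I>" if "{n. \<not> P n} \<in> \<I>"
  proof -
    have "shift_set {n. \<not> P n} (-1) \<in> \<I>"
      using assms(2) that by (simp add: translation_invariant_def)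
    also have "shift_set {n. \<not> P n} (-1) = {n. \<not> P (Suc n)}"
    proof -
      have "int n = int a + - 1 \<longleftrightarrow> a = Suc n" for n a by auto
      then show ?thesis by (simp add: shift_set_def)
    qed
    finally show ?thesis .
  qed
  moreover have "{n. \<not> P n} \<in> \<I>" if "{n. \<not> P (Suc n)} \<in> \<I>"
  proof -
    \<comment> \<open>A shift by 1 never reaches index 0, so the finite set \<open>{0}\<close> is
      added.\<close>
    have "shift_set {n. \<not> P (Suc n)} 1 \<in> \<I>" "{0} \<in> \<I>"
      using assms that by (simp_all add: translation_invariant_def nat_ideal_def)
    then have "shift_set {n. \<not> P (Suc n)} 1 \<union> {0} \<in> \<I>"
      using assms(1) unfolding nat_ideal_def by blast
    moreover have "n \<in> shift_set {n. \<not> P (Suc n)} 1 \<union> {0}" if "\<not> P n" for n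
      using that by (cases n) (auto simp: shift_set_def)
    then have "{n. \<not> P n} \<subseteq> shift_set {n. \<not> P (Suc n)} 1 \<union> {0}" by blast
    ultimately show ?thesis using assms(1) unfolding nat_ideal_def by blast
  qed
  ultimately show "eventually P (filtermap Suc (ideal_filter \<I>)) = eventually P (ideal_filter \<I>)"
    by (auto simp: eventually_filtermap eventually_ideal_filter[OF assms(1)])
qed

lemma ideal_liminf_gt_imp_eventually:
  assumes "nat_ideal \<I>" "\<forall>\<^sub>F n in ideal_filter \<I>. b \<le> a n" "r < ideal_liminf \<I> a"
  shows "\<forall>\<^sub>F n in ideal_filter \<I>. r \<le> a n"
proof -
  \<comment> \<open>The real \<open>Inf\<close> is a lower bound only for sets bounded below; the
    eventual bound \<open>b\<close> on \<open>a\<close> bounds this one.\<close>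
  have "b \<le> r'" if "{n. a n < r'} \<in> positive_sets \<I>" for r'
  proof (rule ccontr)
    assume "\<not> b \<le> r'"
    then have "\<forall>\<^sub>F n in ideal_filter \<I>. r' \<le> a n"
      using assms(2) by (auto elim: eventually_mono)
    then show False
      using that by (simp add: eventually_ideal_filter[OF assms(1)] not_le positive_sets_def)
  qed
  then have "bdd_below {r. {n. a n < r} \<in> positive_sets \<I>}" by (auto intro!: bdd_belowI[of _ b])
  then have "r \<notin> {r. {n. a n < r} \<in> positive_sets \<I>}"
    using assms(3) cInf_lower unfolding ideal_liminf_def by (metis not_le)
  then show ?thesis
    by (simp add: eventually_ideal_filter[OF assms(1)] not_le positive_sets_def)
qed

section \<open>Successors and predecessors of cluster points\<close>

text \<open>Where \<open>x n\<close> tends to \<open>z\<close>, compactness refines the filter to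
  \<open>H\<close> so that \<open>x (Suc n)\<close> tends to some \<open>y\<close>, and the closed
  graph puts \<open>y\<close> in \<open>\<Phi> z\<close>.\<close>

lemma cluster_point_successor:
  fixes x :: "nat \<Rightarrow> 'a::t3_space"
  assumes F: "filtermap Suc F = F" and K: "compact K" "\<forall>\<^sub>F n in F. x n \<in> K"
    and \<Phi>: "\<And>z. upper_hemicontinuous_at \<Phi> z" "\<And>z. closed (\<Phi> z)"
    and x: "feasible_path \<Phi> x" and z: "cluster_point F x z"
  obtains y where "y \<in> \<Phi> z" "cluster_point F x y"
proof -
  obtain G where G: "G \<noteq> bot" "G \<le> F" "(x \<longlongrightarrow> z) G" using z by (rule cluster_pointE)
  have "\<forall>\<^sub>F n in F. x (Suc n) \<in> K"
    using K(2) eventually_filtermap[of "\<lambda>n. x n \<in> K" Suc F] by (simp add: F)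
  then have "\<forall>\<^sub>F n in G. x (Suc n) \<in> K" using G(2) by (rule filter_leD[rotated])
  then obtain y where "cluster_point G (\<lambda>n. x (Suc n)) y"
    using compact_imp_cluster_point[OF K(1) G(1)] by metis
  then obtain H where H: "H \<noteq> bot" "H \<le> G" "((\<lambda>n. x (Suc n)) \<longlongrightarrow> y) H"
    by (rule cluster_pointE)
  have "(x \<longlongrightarrow> z) H" using G(3) H(2) by (rule tendsto_mono[rotated])
  then have "y \<in> \<Phi> z"
    by (rule upper_hemicontinuous_closed_graph[OF \<Phi> H(1) _ H(3)])
       (use x in \<open>simp add: feasible_path_def\<close>)
  moreover have "cluster_point F x y"
  proof (rule cluster_pointI)
    show "filtermap Suc H \<noteq> bot" using H(1) by (simp add: filtermap_bot_iff)
    \<comment> \<open>Moving \<open>H\<close> forward by one index stays below \<open>F\<close> by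
      shift invariance, so \<open>y\<close> is a cluster point of \<open>x\<close> itself.\<close>
    show "filtermap Suc H \<le> F" using filtermap_mono[of H F Suc] F G(2) H(2) by auto
    show "(x \<longlongrightarrow> y) (filtermap Suc H)" using H(3) by (simp add: filterlim_filtermap)
  qed
  ultimately show ?thesis by (rule that)
qed

text \<open>The order is reversed: invariance first makes \<open>y\<close> a cluster point of the
  shifted sequence, then compactness refines the filter so that \<open>x n\<close> converges
  too.\<close>

lemma cluster_point_predecessor:
  fixes x :: "nat \<Rightarrow> 'a::t3_space"
  assumes F: "filtermap Suc F = F" and K: "compact K" "\<forall>\<^sub>F n in F. x n \<in> K"
    and \<Phi>: "\<And>z. upper_hemicontinuous_at \<Phi> z" "\<And>z. closed (\<Phi> z)"
    and x: "feasible_path \<Phi> x" and y: "cluster_point F x y"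
  obtains z where "y \<in> \<Phi> z" "cluster_point F x z"
proof -
  have "eventually P F \<longleftrightarrow> (\<forall>\<^sub>F n in F. P (Suc n))" for P
    using F by (metis eventually_filtermap)
  note shift = this[of "\<lambda>n. x n \<notin> U" for U]
  have "cluster_point F (\<lambda>n. x (Suc n)) y"
    using y unfolding cluster_point_iff_frequently frequently_def by (simp add: shift)
  then obtain G where G: "G \<noteq> bot" "G \<le> F" "((\<lambda>n. x (Suc n)) \<longlongrightarrow> y) G"
    by (rule cluster_pointE)
  have "\<forall>\<^sub>F n in G. x n \<in> K" using G(2) K(2) by (rule filter_leD)
  then obtain z where "cluster_point G x z"
    using compact_imp_cluster_point[OF K(1) G(1)] by metis
  then obtain H where H: "H \<noteq> bot" "H \<le> G" "(x \<longlongrightarrow> z) H"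
    by (rule cluster_pointE)
  have "((\<lambda>n. x (Suc n)) \<longlongrightarrow> y) H" using G(3) H(2) by (rule tendsto_mono[rotated])
  then have "y \<in> \<Phi> z"
    by (rule upper_hemicontinuous_closed_graph[OF \<Phi> H(1) H(3)])
       (use x in \<open>simp add: feasible_path_def\<close>)
  moreover have "cluster_point F x z"
    using H G(2) by (auto intro: cluster_pointI order_trans)
  ultimately show ?thesis by (rule that)
qed

section \<open>Convergence of optimal paths\<close>

theorem theorem2p1:
  fixes \<Phi> :: "'a::real_normed_vector \<Rightarrow> 'a set"
    and u :: "'a \<Rightarrow> real"
    and \<I> :: "nat set set"
    and C :: "(nat \<Rightarrow> 'a) set"
    and \<eta> :: 'a
    and x :: "nat \<Rightarrow> 'a"
  assumes ideal: "nat_ideal \<I>"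
    and C: "C \<noteq> {}" "C \<subseteq> feasible_paths_K \<I> \<Phi>"
    and A1: "continuous_correspondence \<Phi>" "\<And>z. \<Phi> z \<noteq> {} \<and> compact (\<Phi> z)"
    and A2: "continuous_on UNIV u"
    and A3: "translation_invariant \<I>"
    and A4: "\<exists>!z. is_arg_max u (\<lambda>w. w \<in> Fix \<Phi>) z" "is_arg_max u (\<lambda>w. w \<in> Fix \<Phi>) \<eta>"
    and A5: "\<exists>T :: 'a \<Rightarrow> real. bounded_linear T \<and>
              (\<forall>z\<in>{z. u z \<ge> u \<eta>}. \<forall>y\<in>\<Phi> z. T z \<le> T y \<longrightarrow> z = y \<and> y = \<eta>)"
    and A6: "(SUP y\<in>C. ereal (ideal_liminf \<I> (u \<circ> y))) \<ge> ereal (u \<eta>)"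
    and optimal: "ideal_optimal \<I> u C x"
  shows "ideal_converges \<I> x \<eta>"
proof -
  define F where "F = ideal_filter \<I>"
  define \<Gamma> where "\<Gamma> = {z. cluster_point F x z}"
  note ev = eventually_ideal_filter[OF ideal, folded F_def]
  have F: "filtermap Suc F = F"
    unfolding F_def using ideal A3 by (rule filtermap_Suc_ideal_filter)
  have "x \<in> feasible_paths_K \<I> \<Phi>" using optimal C(2) by (auto simp: ideal_optimal_def)
  then obtain K where x: "feasible_path \<Phi> x" and K: "compact K" "{n. x n \<notin> K} \<in> \<I>"
    unfolding feasible_paths_K_def by auto
  have xK: "\<forall>\<^sub>F n in F. x n \<in> K" using K(2) by (simp add: ev)
  have uhc: "\<And>z. upper_hemicontinuous_at \<Phi> z"
    using A1(1) by (simp add: continuous_correspondence_def)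
  have cl: "\<And>z. closed (\<Phi> z)" using A1(2) by (simp add: compact_imp_closed)
  note succ = cluster_point_successor[OF F K(1) xK uhc cl x]
  note pred = cluster_point_predecessor[OF F K(1) xK uhc cl x]
  obtain T :: "'a \<Rightarrow> real" where T: "bounded_linear T"
    and T_strict: "\<And>z y. u \<eta> \<le> u z \<Longrightarrow> y \<in> \<Phi> z \<Longrightarrow> T z \<le> T y \<Longrightarrow> z = \<eta> \<and> y = \<eta>"
    using A5 by auto

  have "(SUP y\<in>C. ereal (ideal_liminf \<I> (u \<circ> y))) \<le> ereal (ideal_liminf \<I> (u \<circ> x))"
    using optimal by (intro SUP_least) (simp add: ideal_optimal_def)
  with A6 have liminf: "u \<eta> \<le> ideal_liminf \<I> (u \<circ> x)"
    by (metis ereal_less_eq(3) order_trans)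
  \<comment> \<open>A bound for \<open>u\<close> on \<open>K\<close> supplies the eventual lower
    bound that the limit inferior lemma asks for.\<close>
  have "bounded (u ` K)"
    using A2 K(1) by (meson compact_continuous_image compact_imp_bounded continuous_on_subset subset_UNIV)
  then obtain B where B: "\<And>z. z \<in> K \<Longrightarrow> \<bar>u z\<bar> \<le> B" by (auto simp: bounded_real)
  have "\<forall>\<^sub>F n in F. - B \<le> (u \<circ> x) n"
    using xK by eventually_elim (use B in force)
  note ge = ideal_liminf_gt_imp_eventually[OF ideal this[unfolded F_def], folded F_def]
  have \<Gamma>_u: "u \<eta> \<le> u z" if "z \<in> \<Gamma>" for z
  \<comment> \<open>Only levels \<open>r\<close> strictly below the limit inferior are eventually
    respected, so \<open>u \<eta>\<close> is approached from below.\<close>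
  proof (rule dense_le)
    fix r assume "r < u \<eta>"
    then have "\<forall>\<^sub>F n in F. x n \<in> {w. r \<le> u w}" using ge liminf by fastforce
    moreover have "closed {w. r \<le> u w}"
      using A2 by (intro closed_Collect_le) auto
    ultimately show "r \<le> u z"
      using that cluster_point_in_closed[of "{w. r \<le> u w}" x F z] by (auto simp: \<Gamma>_def)
  qed

  have "\<Gamma> \<subseteq> K"
    using cluster_point_in_closed[OF compact_imp_closed[OF K(1)] xK] by (auto simp: \<Gamma>_def)
  then have "compact \<Gamma>"
    using K(1) closed_cluster_points[of F x] unfolding \<Gamma>_def
    by (metis compact_Int_closed inf.absorb2)
  have contT: "continuous_on \<Gamma> T" using T by (simp add: linear_continuous_on)
  have unique: "z = \<eta>" if z: "z \<in> \<Gamma>" for z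
  proof -
    \<comment> \<open>The point \<open>z\<close> shows that \<open>\<Gamma>\<close> is nonempty, so
      \<open>T\<close> attains its extrema there.\<close>
    obtain p where p: "p \<in> \<Gamma>" "\<And>w. w \<in> \<Gamma> \<Longrightarrow> T p \<le> T w"
      using continuous_attains_inf[OF \<open>compact \<Gamma>\<close> _ contT] z by blast
    obtain q where q: "q \<in> \<Gamma>" "\<And>w. w \<in> \<Gamma> \<Longrightarrow> T w \<le> T q"
      using continuous_attains_sup[OF \<open>compact \<Gamma>\<close> _ contT] z by blast
    obtain p' where "p' \<in> \<Phi> p" "p' \<in> \<Gamma>" using succ[of p] p(1) by (auto simp: \<Gamma>_def)
    then have "p = \<eta>" using T_strict \<Gamma>_u p by blast
    \<comment> \<open>At the maximum (A5) is applied at the predecessor: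
      \<open>T q' \<le> T q\<close> with \<open>q \<in> \<Phi> q'\<close>.\<close>
    obtain q' where "q \<in> \<Phi> q'" "q' \<in> \<Gamma>" using pred[of q] q(1) by (auto simp: \<Gamma>_def)
    then have "q = \<eta>" using T_strict \<Gamma>_u q by blast
    obtain z' where z': "z' \<in> \<Phi> z" "z' \<in> \<Gamma>" using succ[of z] z by (auto simp: \<Gamma>_def)
    have "T z \<le> T z'" using q(2)[OF z] p(2)[OF z'(2)] \<open>p = \<eta>\<close> \<open>q = \<eta>\<close> by simp
    then show "z = \<eta>" using T_strict \<Gamma>_u z z' by blast
  qed
  have "(x \<longlongrightarrow> \<eta>) F"
    using K(1) xK by (rule unique_cluster_point_tendsto) (simp add: unique \<Gamma>_def)
  then show ?thesis
    unfolding ideal_converges_def dual_filter_def tendsto_def by (simp add: ev Collect_neg_eq)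
qed

end
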